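(* The map $\mathcal C(\mathcal H)\to\mathbb N_0$, $C_\varphi\mapsto\mathrm{char}(\varphi)$, is continuous, where $\mathcal C(\mathcal H)$ carries the operator norm topology and $\mathbb N_0=\{0,1,2,\dots\}$ the discrete topology.
   Context: For $\theta\in\mathbb R$, $\mathbb C_\theta=\{s\in\mathbb C:\ \mathrm{Re}\, s>\theta\}$. $\mathcal H$ is the Hilbert space of Dirichlet series $f(s)=\sum_{n\ge1}a_nn^{-s}$ with $\|f\|^2=\sum_n|a_n|^2<\infty$; its elements are analytic on $\mathbb C_{1/2}$. The Gordon-Hedenmalm class $\mathcal G$ is the set of maps $\varphi:\mathbb C_{1/2}\to\mathbb C_{1/2}$ of the form $\varphi(s)=c_0s+\psi(s)$, where $c_0=:\mathrm{char}(\varphi)$ is a non-negative integer (the characteristic of $\varphi$) and $\psi(s)=\sum_{n\ge1}c_nn^{-s}$ converges uniformly in $\mathbb C_\varepsilon$ for every $\varepsilon>0$ and satisfies: (a) if $c_0=0$, then $\psi(\mathbb C_0)\subseteq\mathbb C_{1/2}$; (b) if $c_0\ge1$, then either $\psi\equiv c_1$ with $\mathrm{Re}\,c_1\ge0$ or $\psi(\mathbb C_0)\subseteq\mathbb C_0$. These are exactly the analytic self-maps $\varphi$ of $\mathbb C_{1/2}$ for which $C_\varphi f=f\circ\varphi$ defines a bounded operator on $\mathcal H$. $\mathcal C(\mathcal H)=\{C_\varphi:\ \varphi\in\mathcal G\}$ is the set of bounded composition operators on $\mathcal H$, endowed with the operator norm topology. *)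

theory Defs
  imports "HOL-Analysis.Analysis"
begin

definition half_plane :: "real \<Rightarrow> complex set" where
  "half_plane \<theta> = {s. Re s > \<theta>}"

text \<open>
  Coefficients are indexed by \<^typ>\<open>nat\<close>. The term of index 0 vanishes since
  \<^term>\<open>0 powr z = (0::complex)\<close>, so both series below effectively start at index 1.
\<close>

definition dirichlet_partial :: "(nat \<Rightarrow> complex) \<Rightarrow> nat \<Rightarrow> complex \<Rightarrow> complex" where
  "dirichlet_partial a N s = (\<Sum>n<N. a n * of_nat n powr (- s))"

definition dirichlet :: "(nat \<Rightarrow> complex) \<Rightarrow> complex \<Rightarrow> complex" where
  "dirichlet a s = (\<Sum>n. a n * of_nat n powr (- s))"


text \<open>
  The Hilbert space of Dirichlet series with square summable coefficients. A series is
  represented by its coefficient sequence, with the unused coefficient of index 0 set to 0;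
  the function it defines on \<^term>\<open>half_plane (1/2)\<close> is \<open>hval\<close> below.
\<close>

typedef hdir = "{a :: nat \<Rightarrow> complex. a 0 = 0 \<and> summable (\<lambda>n. (cmod (a n))\<^sup>2)}"
  morphisms hcoeff Abs_hdir
  by (rule exI[of _ "\<lambda>_. 0"]) simp

definition hval :: "hdir \<Rightarrow> complex \<Rightarrow> complex" where
  "hval f = dirichlet (hcoeff f)"

lemma hcoeff_0 [simp]: "hcoeff f 0 = 0"
  using hcoeff[of f] by simp

lemma summable_hcoeff: "summable (\<lambda>n. (cmod (hcoeff f n))\<^sup>2)"
  using hcoeff[of f] by simp

lemma hcoeff_Abs:
  "a 0 = 0 \<Longrightarrow> summable (\<lambda>n. (cmod (a n))\<^sup>2) \<Longrightarrow> hcoeff (Abs_hdir a) = a"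
  by (simp add: Abs_hdir_inverse)

lemma hdir_eqI: "(\<And>n. hcoeff f n = hcoeff g n) \<Longrightarrow> f = g"
  by (metis ext hcoeff_inject)

lemma summable_square_add:
  fixes a b :: "nat \<Rightarrow> complex"
  assumes "summable (\<lambda>n. (cmod (a n))\<^sup>2)" "summable (\<lambda>n. (cmod (b n))\<^sup>2)"
  shows "summable (\<lambda>n. (cmod (a n + b n))\<^sup>2)"
proof (rule summable_comparison_test')
  show "summable (\<lambda>n. 2 * (cmod (a n))\<^sup>2 + 2 * (cmod (b n))\<^sup>2)"
    using assms by (intro summable_add summable_mult)
  show "norm ((cmod (a n + b n))\<^sup>2) \<le> 2 * (cmod (a n))\<^sup>2 + 2 * (cmod (b n))\<^sup>2" if "n \<ge> 0" for n
  proof -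
    have "(cmod (a n + b n))\<^sup>2 \<le> (cmod (a n) + cmod (b n))\<^sup>2"
      by (intro power_mono norm_triangle_ineq) simp
    also have "\<dots> \<le> 2 * (cmod (a n))\<^sup>2 + 2 * (cmod (b n))\<^sup>2"
      using sum_squares_bound[of "cmod (a n)" "cmod (b n)"] by (simp add: power2_sum)
    finally show ?thesis by simp
  qed
qed

lemma summable_square_scaleR:
  fixes a :: "nat \<Rightarrow> complex"
  shows "summable (\<lambda>n. (cmod (a n))\<^sup>2) \<Longrightarrow> summable (\<lambda>n. (cmod (r *\<^sub>R a n))\<^sup>2)"
  by (simp add: power_mult_distrib summable_mult)

lemma summable_inner_hcoeff: "summable (\<lambda>n. hcoeff f n \<bullet> hcoeff g n)"
proof (rule summable_comparison_test')
  show "summable (\<lambda>n. (cmod (hcoeff f n))\<^sup>2 + (cmod (hcoeff g n))\<^sup>2)"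
    by (intro summable_add summable_hcoeff)
  show "norm (hcoeff f n \<bullet> hcoeff g n) \<le> (cmod (hcoeff f n))\<^sup>2 + (cmod (hcoeff g n))\<^sup>2"
    if "n \<ge> 0" for n
  proof -
    have "norm (hcoeff f n \<bullet> hcoeff g n) \<le> cmod (hcoeff f n) * cmod (hcoeff g n)"
      using Cauchy_Schwarz_ineq2 by simp
    also have "\<dots> \<le> (cmod (hcoeff f n))\<^sup>2 + (cmod (hcoeff g n))\<^sup>2"
      using sum_squares_bound[of "cmod (hcoeff f n)" "cmod (hcoeff g n)"]
        mult_nonneg_nonneg[OF norm_ge_zero[of "hcoeff f n"] norm_ge_zero[of "hcoeff g n"]]
      by linarith
    finally show ?thesis .
  qed
qed

instantiation hdir :: real_vector
begin

definition "0 = Abs_hdir (\<lambda>_. 0)"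
definition "f + g = Abs_hdir (\<lambda>n. hcoeff f n + hcoeff g n)"
definition "- f = Abs_hdir (\<lambda>n. - hcoeff f n)"
definition "f - g = Abs_hdir (\<lambda>n. hcoeff f n - hcoeff g n)"
definition "r *\<^sub>R f = Abs_hdir (\<lambda>n. r *\<^sub>R hcoeff f n)"

lemma hcoeff_zero [simp]: "hcoeff 0 = (\<lambda>_. 0)"
  unfolding zero_hdir_def by (rule hcoeff_Abs) simp_all

lemma hcoeff_add [simp]: "hcoeff (f + g) = (\<lambda>n. hcoeff f n + hcoeff g n)"
  unfolding plus_hdir_def
  by (rule hcoeff_Abs) (simp_all add: summable_square_add summable_hcoeff)

lemma hcoeff_uminus [simp]: "hcoeff (- f) = (\<lambda>n. - hcoeff f n)"
  unfolding uminus_hdir_def by (rule hcoeff_Abs) (simp_all add: summable_hcoeff)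

lemma hcoeff_diff [simp]: "hcoeff (f - g) = (\<lambda>n. hcoeff f n - hcoeff g n)"
  unfolding minus_hdir_def
  using summable_square_add[OF summable_hcoeff[of f], of "\<lambda>n. - hcoeff g n"]
  by (intro hcoeff_Abs) (simp_all add: summable_hcoeff)

lemma hcoeff_scaleR [simp]: "hcoeff (r *\<^sub>R f) = (\<lambda>n. r *\<^sub>R hcoeff f n)"
  unfolding scaleR_hdir_def
  by (rule hcoeff_Abs) (use summable_square_scaleR summable_hcoeff in simp_all)

instance
  by standard (auto intro!: hdir_eqI simp: algebra_simps)

end

text \<open>
  The real inner product (the real part of the complex one) carries the norm. It is enough here:
  the operator norm of a complex linear operator does not depend on the choice of scalars.
\<close>

instantiation hdir :: real_inner
begin

definition "inner f g = (\<Sum>n. hcoeff f n \<bullet> hcoeff g n)"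
definition "norm f = sqrt (\<Sum>n. (cmod (hcoeff f n))\<^sup>2)"
definition "dist f g = norm (f - g :: hdir)"
definition "sgn f = (f :: hdir) /\<^sub>R norm f"
definition [code del]:
  "(uniformity :: (hdir \<times> hdir) filter) = (INF e\<in>{0<..}. principal {(x, y). dist x y < e})"
definition [code del]:
  "open (U :: hdir set) \<longleftrightarrow> (\<forall>x\<in>U. eventually (\<lambda>(x', y). x' = x \<longrightarrow> y \<in> U) uniformity)"

instance
proof
  fix f g h :: hdir and r :: real
  show "inner f g = inner g f"
    unfolding inner_hdir_def by (simp only: inner_commute)
  show "inner (f + g) h = inner f h + inner g h"
    unfolding inner_hdir_def
    by (simp add: inner_add_left suminf_add summable_inner_hcoeff)
  show "inner (r *\<^sub>R f) g = r * inner f g"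
    unfolding inner_hdir_def
    by (simp add: suminf_mult summable_inner_hcoeff)
  show "0 \<le> inner f f"
    unfolding inner_hdir_def by (intro suminf_nonneg summable_inner_hcoeff) simp
  show "inner f f = 0 \<longleftrightarrow> f = 0"
  proof
    assume "inner f f = 0"
    then have "\<forall>n. hcoeff f n \<bullet> hcoeff f n = 0"
      unfolding inner_hdir_def
      using suminf_eq_zero_iff[OF summable_inner_hcoeff[of f f]] by simp
    then show "f = 0" by (intro hdir_eqI) simp
  qed (simp add: inner_hdir_def)
  show "norm f = sqrt (inner f f)"
    unfolding norm_hdir_def inner_hdir_def by (simp add: power2_norm_eq_inner)
qed (simp_all add: dist_hdir_def sgn_hdir_def uniformity_hdir_def open_hdir_def)

end


text \<open>
  \<open>is_symbol c0 \<phi>\<close>: the map \<open>\<phi>\<close> belongs to the Gordon-Hedenmalm class, with characteristic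
  \<open>c0\<close>. Membership in the extensional function space makes \<open>\<phi>\<close> a map with domain
  \<^term>\<open>half_plane (1/2)\<close>.
\<close>

definition is_symbol :: "nat \<Rightarrow> (complex \<Rightarrow> complex) \<Rightarrow> bool" where
  "is_symbol c0 \<phi> \<longleftrightarrow>
     \<phi> \<in> half_plane (1/2) \<rightarrow>\<^sub>E half_plane (1/2) \<and>
     (\<exists>c :: nat \<Rightarrow> complex.
        (\<forall>\<epsilon>>0. uniform_limit (half_plane \<epsilon>) (dirichlet_partial c) (dirichlet c) sequentially) \<and>
        (\<forall>s\<in>half_plane (1/2). \<phi> s = of_nat c0 * s + dirichlet c s) \<and>
        (c0 = 0 \<longrightarrow> dirichlet c ` half_plane 0 \<subseteq> half_plane (1/2)) \<and>
        (c0 \<ge> 1 \<longrightarrow>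
           ((\<forall>s\<in>half_plane 0. dirichlet c s = c 1) \<and> Re (c 1) \<ge> 0) \<or>
           dirichlet c ` half_plane 0 \<subseteq> half_plane 0))"

definition GH_class :: "(complex \<Rightarrow> complex) set" where
  "GH_class = {\<phi>. \<exists>c0. is_symbol c0 \<phi>}"

definition char_of :: "(complex \<Rightarrow> complex) \<Rightarrow> nat" where
  "char_of \<phi> = (THE c0. is_symbol c0 \<phi>)"


text \<open>
  \<open>is_comp_op \<phi> T\<close>: the bounded operator \<open>T\<close> is the composition operator with symbol \<open>\<phi>\<close>.
  Type \<^typ>\<open>hdir \<Rightarrow>\<^sub>L hdir\<close> consists of the bounded real linear operators, but such a \<open>T\<close> is
  automatically complex linear. This is a relation because the existence of \<open>T\<close> for every symbol
  in the class is the theorem of Gordon and Hedenmalm.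
\<close>

definition is_comp_op :: "(complex \<Rightarrow> complex) \<Rightarrow> (hdir \<Rightarrow>\<^sub>L hdir) \<Rightarrow> bool" where
  "is_comp_op \<phi> T \<longleftrightarrow> (\<forall>f. \<forall>s\<in>half_plane (1/2). hval (blinfun_apply T f) s = hval f (\<phi> s))"

definition comp_ops :: "(hdir \<Rightarrow>\<^sub>L hdir) set" where
  "comp_ops = {T. \<exists>\<phi>\<in>GH_class. is_comp_op \<phi> T}"

definition op_char :: "(hdir \<Rightarrow>\<^sub>L hdir) \<Rightarrow> nat" where
  "op_char T = (THE k. \<exists>\<phi>\<in>GH_class. is_comp_op \<phi> T \<and> char_of \<phi> = k)"


text \<open>
  Both definite descriptions are legitimate: the characteristic is determined by the real part of
  the symbol, which in turn is determined by the composition operator.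
\<close>

lemma uniform_dirichlet_bounded:
  assumes "uniform_limit (half_plane (1/2)) (dirichlet_partial c) (dirichlet c) sequentially"
  obtains B where "\<And>s. s \<in> half_plane (1/2) \<Longrightarrow> cmod (dirichlet c s) \<le> B"
proof -
  from assms have "\<forall>\<^sub>F N in sequentially.
      \<forall>s\<in>half_plane (1/2). dist (dirichlet_partial c N s) (dirichlet c s) < 1"
    using uniform_limitD zero_less_one by blast
  then obtain N where
    N: "\<And>s. s \<in> half_plane (1/2) \<Longrightarrow> dist (dirichlet_partial c N s) (dirichlet c s) < 1"
    using eventually_happens'[OF sequentially_bot] by blast
  have "cmod (dirichlet c s) \<le> (\<Sum>n<N. cmod (c n)) + 1" if s: "s \<in> half_plane (1/2)" for s
  proof -
    have "cmod (of_nat n powr (- s)) \<le> 1" for n :: nat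
    proof (cases "n = 0")
      case False
      then have "cmod (of_nat n powr (- s)) = real n powr (- Re s)"
        using norm_powr_real_powr[of "of_nat n" "- s"] by simp
      also have "\<dots> \<le> real n powr 0"
        using False s by (intro powr_mono) (auto simp: half_plane_def)
      finally show ?thesis using False by simp
    qed simp
    then have "cmod (dirichlet_partial c N s) \<le> (\<Sum>n<N. cmod (c n))"
      unfolding dirichlet_partial_def
      by (intro sum_norm_le) (simp add: norm_mult mult_left_le)
    moreover have "cmod (dirichlet c s) \<le>
        cmod (dirichlet_partial c N s) + dist (dirichlet_partial c N s) (dirichlet c s)"
      by (metis add.commute dist_norm norm_triangle_sub norm_minus_commute)
    ultimately show ?thesis using N[OF s] by linarith
  qed
  then show ?thesis using that by blast
qed

lemma is_symbol_char_unique: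
  assumes "is_symbol k \<phi>" "is_symbol l \<psi>"
    and eq: "\<And>s. s \<in> half_plane (1/2) \<Longrightarrow> Re (\<phi> s) = Re (\<psi> s)"
  shows "k = l"
proof -
  obtain c where c: "\<forall>\<epsilon>>0. uniform_limit (half_plane \<epsilon>) (dirichlet_partial c) (dirichlet c) sequentially"
      "\<forall>s\<in>half_plane (1/2). \<phi> s = of_nat k * s + dirichlet c s"
    using assms(1) unfolding is_symbol_def by blast
  obtain d where d: "\<forall>\<epsilon>>0. uniform_limit (half_plane \<epsilon>) (dirichlet_partial d) (dirichlet d) sequentially"
      "\<forall>s\<in>half_plane (1/2). \<psi> s = of_nat l * s + dirichlet d s"
    using assms(2) unfolding is_symbol_def by blast
  obtain B where B: "\<And>s. s \<in> half_plane (1/2) \<Longrightarrow> cmod (dirichlet c s) \<le> B"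
    using uniform_dirichlet_bounded c(1) by (metis half_gt_zero_iff zero_less_one)
  obtain D where D: "\<And>s. s \<in> half_plane (1/2) \<Longrightarrow> cmod (dirichlet d s) \<le> D"
    using uniform_dirichlet_bounded d(1) by (metis half_gt_zero_iff zero_less_one)
  show "k = l"
  proof (rule ccontr)
    assume "k \<noteq> l"
    then have one: "1 \<le> \<bar>real k - real l\<bar>" by linarith
    define t where "t = \<bar>B\<bar> + \<bar>D\<bar> + 1"
    have t: "complex_of_real t \<in> half_plane (1/2)" by (simp add: half_plane_def t_def)
    have "real k * t + Re (dirichlet c t) = real l * t + Re (dirichlet d t)"
      using eq[OF t] c(2) d(2) t by simp
    then have "(real k - real l) * t = Re (dirichlet d t) - Re (dirichlet c t)"
      by (simp add: left_diff_distrib)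
    moreover have "\<bar>t\<bar> = t" by (simp add: t_def)
    ultimately have "\<bar>real k - real l\<bar> * t = \<bar>Re (dirichlet d t) - Re (dirichlet c t)\<bar>"
      by (metis abs_mult)
    also have "\<dots> \<le> B + D"
      using B[OF t] D[OF t] abs_Re_le_cmod[of "dirichlet c t"] abs_Re_le_cmod[of "dirichlet d t"]
      by linarith
    also have "\<dots> < t" by (simp add: t_def)
    finally show False using one mult_right_mono[OF one, of t] by (simp add: t_def)
  qed
qed

lemma char_of_eq: "is_symbol c0 \<phi> \<Longrightarrow> char_of \<phi> = c0"
  unfolding char_of_def by (rule the_equality) (use is_symbol_char_unique in blast)+

lemma comp_op_Re_unique:
  assumes "is_comp_op \<phi> T" "is_comp_op \<psi> T" "s \<in> half_plane (1/2)"
  shows "Re (\<phi> s) = Re (\<psi> s)"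
proof -
  define e where "e = Abs_hdir (\<lambda>n. if n = 2 then 1 else 0)"
  have "summable (\<lambda>n. (cmod (if n = 2 then 1 else 0))\<^sup>2)"
    by (rule summable_finite[of "{2::nat}"]) auto
  then have e: "hcoeff e = (\<lambda>n. if n = 2 then 1 else 0)"
    unfolding e_def by (intro hcoeff_Abs) auto
  have val: "hval e z = 2 powr (- z)" for z
    unfolding hval_def dirichlet_def e
    by (subst suminf_finite[of "{2}"]) auto
  have "(2::complex) powr (- \<phi> s) = 2 powr (- \<psi> s)"
    using assms unfolding is_comp_op_def by (metis val)
  then have "cmod (2 powr (- \<phi> s)) = cmod (2 powr (- \<psi> s))" by simp
  then show ?thesis by (simp add: norm_powr_real_powr powr_inj)
qed

lemma op_char_eq:
  assumes "\<phi> \<in> GH_class" "is_comp_op \<phi> T"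
  shows "op_char T = char_of \<phi>"
  unfolding op_char_def
proof (rule the_equality)
  show "\<exists>\<psi>\<in>GH_class. is_comp_op \<psi> T \<and> char_of \<psi> = char_of \<phi>"
    using assms by blast
next
  fix k assume "\<exists>\<psi>\<in>GH_class. is_comp_op \<psi> T \<and> char_of \<psi> = k"
  then obtain \<psi> where \<psi>: "\<psi> \<in> GH_class" "is_comp_op \<psi> T" "char_of \<psi> = k" by blast
  obtain a b where ab: "is_symbol a \<phi>" "is_symbol b \<psi>"
    using assms \<psi> unfolding GH_class_def by blast
  have "b = a"
    using is_symbol_char_unique[OF ab(2,1)] comp_op_Re_unique[OF \<psi>(2) assms(2)] by blast
  then show "k = char_of \<phi>"
    using char_of_eq[OF ab(1)] char_of_eq[OF ab(2)] \<psi>(3) by simp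
qed

end

theory Submission
  imports Defs "HOL-Real_Asymp.Real_Asymp"
begin

text \<open>
  An operator \<open>S\<close> close to a fixed composition operator \<open>T\<close> has a symbol that is close, in real
  part, to the symbol of \<open>T\<close> at any prescribed point. Indeed, \<open>T\<close> sends the basis vector
  \<open>2\<^sup>-\<^sup>s\<close> to \<open>2 powr - \<phi> s\<close>, and point evaluations are bounded functionals, so closeness of \<open>T\<close> and
  \<open>S\<close> forces closeness of \<open>2 powr - Re (\<phi> s)\<close> and \<open>2 powr - Re (\<psi> s)\<close>
  (\<open>close_comp_ops_close_symbols\<close>).

  For large real \<open>s\<close> the real part of \<open>\<phi>\<close> is \<open>a s + O(1)\<close>, where \<open>a\<close> is the characteristic, so
  closeness at one far point should already reveal \<open>a\<close>. The obstacle is uniformity: the point must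
  be chosen before \<open>\<psi>\<close> is known, while the bounded part \<open>d(s)\<close> of \<open>\<psi>(s) = b s + d(s)\<close> can be
  arbitrarily large, which could mask a deficit \<open>b < a\<close>. What saves the argument is that
  \<open>Re d \<ge> 0\<close>. A Dirichlet series with nonnegative real part satisfies a Harnack inequality that
  does not deteriorate to the right: its coefficients are controlled by twice the real part of the
  constant one (\<open>dirichlet_coeff_bound\<close>), hence its real part is comparable to that
  single number on a whole ray (\<open>dirichlet_near_constant_coeff\<close>). Therefore closeness at one
  auxiliary point \<open>s1\<close>, where \<open>Re \<phi>\<close> has a fixed value, bounds \<open>Re d\<close> on the entire ray by a number
  depending on \<open>\<phi>\<close> only, and closeness at a second point \<open>s0\<close>, far beyond that bound, yields
  \<open>b = a\<close> (\<open>char_locally_constant\<close>).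
\<close>

section \<open>Coefficients of Dirichlet series with nonnegative real part\<close>

text \<open>
  The zero-frequency part is the mean value. Instead of averaging over long intervals, the
  proof integrates explicitly: a primitive of the real part is a linear function of slope \<open>A\<close>, the
  mean, plus the bounded function \<open>g\<close>. A nondecreasing function of this form has \<open>A \<ge> 0\<close>.
\<close>

lemma trig_sum_mean_nonneg:
  fixes a :: "'i \<Rightarrow> complex" and l :: "'i \<Rightarrow> real"
  assumes fin: "finite I"
    and nonneg: "\<And>t. 0 \<le> Re (\<Sum>i\<in>I. a i * cis (l i * t))"
  shows "0 \<le> Re (\<Sum>i | i \<in> I \<and> l i = 0. a i)"
proof (rule ccontr)
  define A where "A = Re (\<Sum>i | i \<in> I \<and> l i = 0. a i)"
  define J where "J = {i\<in>I. l i \<noteq> 0}"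
  define g where "g t = (\<Sum>i\<in>J. Re (a i) / l i * sin (l i * t) + Im (a i) / l i * cos (l i * t))" for t
  define B where "B = (\<Sum>i\<in>J. \<bar>Re (a i) / l i\<bar> + \<bar>Im (a i) / l i\<bar>)"
  have split: "(\<Sum>i\<in>I. f i) = (\<Sum>i | i \<in> I \<and> l i = 0. f i) + (\<Sum>i\<in>J. f i)" for f :: "'i \<Rightarrow> complex"
    unfolding J_def using fin
    by (subst sum.union_disjoint[symmetric]) (auto intro!: sum.cong)
  have deriv: "((\<lambda>t. A * t + g t) has_real_derivative Re (\<Sum>i\<in>I. a i * cis (l i * t))) (at t)" for t
  proof -
    have "(g has_real_derivative (\<Sum>i\<in>J. Re (a i * cis (l i * t)))) (at t)"
      unfolding g_def
    proof (rule DERIV_sum)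
      fix i assume "i \<in> J"
      then have "l i \<noteq> 0" by (simp add: J_def)
      have "((\<lambda>t. Re (a i) / l i * sin (l i * t) + Im (a i) / l i * cos (l i * t)) has_real_derivative
          Re (a i) / l i * (l i * cos (l i * t)) + Im (a i) / l i * (- (l i * sin (l i * t)))) (at t)"
        by (rule derivative_eq_intros refl | simp)+
      then show "((\<lambda>t. Re (a i) / l i * sin (l i * t) + Im (a i) / l i * cos (l i * t)) has_real_derivative
          Re (a i * cis (l i * t))) (at t)"
        using \<open>l i \<noteq> 0\<close> by simp
    qed
    moreover have "(\<Sum>i | i \<in> I \<and> l i = 0. a i * cis (l i * t)) = (\<Sum>i | i \<in> I \<and> l i = 0. a i)"
      by (rule sum.cong) auto
    ultimately show ?thesis
      unfolding split by (auto intro!: derivative_eq_intros simp: A_def)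
  qed
  have gB: "\<bar>g t\<bar> \<le> B" for t
  proof -
    have "\<bar>Re (a i) / l i * sin (l i * t) + Im (a i) / l i * cos (l i * t)\<bar>
        \<le> \<bar>Re (a i) / l i\<bar> + \<bar>Im (a i) / l i\<bar>" for i
    proof -
      have "\<bar>Re (a i) / l i * sin (l i * t)\<bar> \<le> \<bar>Re (a i) / l i\<bar>"
        using mult_left_le[OF abs_sin_le_one, of "\<bar>Re (a i) / l i\<bar>" "l i * t"]
        by (simp add: abs_mult)
      moreover have "\<bar>Im (a i) / l i * cos (l i * t)\<bar> \<le> \<bar>Im (a i) / l i\<bar>"
        using mult_left_le[OF abs_cos_le_one, of "\<bar>Im (a i) / l i\<bar>" "l i * t"]
        by (simp add: abs_mult)
      ultimately show ?thesis by linarith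
    qed
    then show ?thesis
      unfolding g_def B_def by (intro order_trans[OF sum_abs] sum_mono)
  qed
  assume "\<not> 0 \<le> Re (\<Sum>i | i \<in> I \<and> l i = 0. a i)"
  then have A: "A < 0" by (simp add: A_def)
  define t where "t = (2 * B + 1) / - A"
  have "0 \<le> B" using gB[of 0] by linarith
  with A have "0 \<le> t" by (simp add: t_def divide_nonneg_neg)
  then have "A * 0 + g 0 \<le> A * t + g t"
    by (rule DERIV_nonneg_imp_nondecreasing) (use deriv nonneg in blast)
  moreover have "A * t = - (2 * B + 1)" using A by (simp add: t_def field_simps)
  ultimately show False using gB[of 0] gB[of t] by linarith
qed

lemma nat_powr_line:
  assumes "0 < n"
  shows "of_nat n powr - Complex \<sigma> t = of_real (real n powr - \<sigma>) * cis (- ln (real n) * t)"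
proof -
  have "of_nat n powr - Complex \<sigma> t = exp (- Complex \<sigma> t * of_real (ln (real n)))"
    using assms by (simp add: powr_def Ln_of_nat)
  also have "- Complex \<sigma> t * of_real (ln (real n))
      = of_real (- \<sigma> * ln (real n)) + \<i> * of_real (- ln (real n) * t)"
    by (simp add: complex_eq_iff)
  finally show ?thesis
    unfolding exp_add cis_conv_exp exp_of_real using assms by (simp add: powr_def)
qed

text \<open>
  The Caratheodory coefficient bound for frequencies \<open>ln n\<close>. Multiplying by the nonnegative factor
  \<open>1 + Re (w k\<^sup>i\<^sup>t)\<close> with \<open>cmod w \<le> 1\<close> preserves the sign of the real part, and the mean of the
  product is \<open>b 1 + b k * w / 2\<close>, because all frequencies \<open>ln n\<close> are nonnegative and so the conjugate
  half of the factor contributes nothing. The bound follows by letting \<open>w\<close> rotate \<open>b k\<close> to the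
  negative axis.
\<close>

lemma dirichlet_polynomial_coeff_bound:
  fixes b :: "nat \<Rightarrow> complex"
  assumes k: "2 \<le> k" "k < N"
    and nonneg: "\<And>t. 0 \<le> Re (\<Sum>n\<in>{1..<N}. b n * cis (- ln (real n) * t))"
  shows "cmod (b k) \<le> 2 * Re (b 1)"
proof -
  define w where "w = - cnj (sgn (b k))"
  \<comment> \<open>The product has one term per pair of \<open>n\<close> and a frequency \<open>j * ln k\<close> of the factor.\<close>
  define c where "c j = (if j = 0 then 1 else if j = 1 then w / 2 else cnj w / 2)" for j :: int
  define a where "a = (\<lambda>(n, j). b n * c j)"
  define l where "l = (\<lambda>(n, j). real_of_int j * ln (real k) - ln (real n))"
  define I where "I = {1..<N} \<times> {-1, 0, 1::int}"
  have w: "cmod w \<le> 1" by (simp add: w_def norm_sgn)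
  have "0 \<le> Re (\<Sum>i\<in>I. a i * cis (l i * t))" for t
  proof -
    define z where "z = w * cis (ln (real k) * t)"
    have z: "1 + (z + cnj z) / 2 = of_real (1 + Re z)"
      by (simp add: complex_eq_iff)
    have "(\<Sum>i\<in>I. a i * cis (l i * t)) =
        (\<Sum>n\<in>{1..<N}. \<Sum>j\<in>{-1, 0, 1}. a (n, j) * cis (l (n, j) * t))"
      unfolding I_def sum.cartesian_product by (simp add: case_prod_unfold)
    also have "\<dots> = (\<Sum>n\<in>{1..<N}. (b n * cis (- ln (real n) * t)) * of_real (1 + Re z))"
    proof (rule sum.cong)
      fix n
      have e: "cis (l (n, j) * t) = cis (of_int j * (ln (real k) * t)) * cis (- ln (real n) * t)" for j
        by (simp add: l_def cis_mult algebra_simps)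
      have cz: "cnj z = cnj w * cis (- (ln (real k) * t))"
        by (simp add: z_def cis_cnj)
      show "(\<Sum>j\<in>{-1, 0, 1}. a (n, j) * cis (l (n, j) * t)) =
          (b n * cis (- ln (real n) * t)) * of_real (1 + Re z)"
        unfolding z[symmetric] unfolding cz e unfolding z_def
        by (simp add: a_def c_def field_simps)
    qed simp
    also have "Re \<dots> = Re (\<Sum>n\<in>{1..<N}. b n * cis (- ln (real n) * t)) * (1 + Re z)"
      by (simp flip: sum_distrib_right)
    finally have eq: "Re (\<Sum>i\<in>I. a i * cis (l i * t)) =
      Re (\<Sum>n\<in>{1..<N}. b n * cis (- ln (real n) * t)) * (1 + Re z)" .
    have "\<bar>Re z\<bar> \<le> 1"
      using abs_Re_le_cmod[of z] w by (simp add: z_def norm_mult)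
    then show ?thesis unfolding eq using nonneg by (intro mult_nonneg_nonneg) auto
  qed
  then have "0 \<le> Re (\<Sum>i | i \<in> I \<and> l i = 0. a i)"
    by (intro trig_sum_mean_nonneg) (auto simp: I_def)
  also have "{i. i \<in> I \<and> l i = 0} = {(1, 0), (k, 1)}"
  proof -
    have no_zero: False if "- ln (real k) = ln (real n)" "Suc 0 \<le> n" for n
    proof -
      have "0 < ln (real k)" using k by simp
      moreover have "0 \<le> ln (real n)" using that(2) by simp
      ultimately show ?thesis using that(1) by linarith
    qed
    show ?thesis using k by (auto simp: I_def l_def dest: no_zero)
  qed
  also have "(\<Sum>i\<in>{(1, 0), (k, 1)}. a i) = b 1 + b k * w / 2"
    by (simp add: a_def c_def)
  also have "b k * w = - of_real (cmod (b k))"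
    by (cases "b k = 0") (simp_all add: w_def sgn_eq complex_norm_square[symmetric] power2_eq_square)
  finally show ?thesis by simp
qed

text \<open>
  On the vertical line a late partial sum has real part at least \<open>- e / 2\<close>. Adding \<open>e / 2\<close> to its
  constant term puts it in reach of the bound for Dirichlet polynomials.
\<close>

lemma dirichlet_coeff_bound:
  assumes lim: "uniform_limit {s. Re s = \<sigma>} (dirichlet_partial c) (dirichlet c) sequentially"
    and nonneg: "\<And>s. Re s = \<sigma> \<Longrightarrow> 0 \<le> Re (dirichlet c s)"
    and k: "2 \<le> k"
  shows "cmod (c k) * real k powr - \<sigma> \<le> 2 * Re (c 1)"
proof (rule field_le_epsilon)
  fix e :: real assume e: "0 < e"
  have "\<forall>\<^sub>F N in sequentially. \<forall>s\<in>{s. Re s = \<sigma>}. dist (dirichlet_partial c N s) (dirichlet c s) < e / 2"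
    using uniform_limitD[OF lim, of "e / 2"] e by simp
  then obtain N where N: "\<And>s. Re s = \<sigma> \<Longrightarrow> dist (dirichlet_partial c N s) (dirichlet c s) < e / 2"
    and kN: "k < N"
    using eventually_happens'[OF sequentially_bot eventually_conj[OF _ eventually_gt_at_top[of k]]]
    by blast
  define b where "b n = c n * of_real (real n powr - \<sigma>) + (if n = 1 then of_real (e / 2) else 0)" for n
  have "0 \<le> Re (\<Sum>n\<in>{1..<N}. b n * cis (- ln (real n) * t))" for t
  proof -
    define s where "s = Complex \<sigma> t"
    have "{..<N} = insert 0 {1..<N}" using kN by auto
    then have "dirichlet_partial c N s = (\<Sum>n\<in>{1..<N}. c n * of_nat n powr - s)"
      unfolding dirichlet_partial_def by simp
    then have "dirichlet_partial c N s + of_real (e / 2) =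
       (\<Sum>n\<in>{1..<N}. c n * of_nat n powr - s) + (\<Sum>n\<in>{1..<N}. if n = 1 then of_real (e / 2) else 0)"
      using k kN by simp
    also have "\<dots> = (\<Sum>n\<in>{1..<N}. b n * cis (- ln (real n) * t))"
      unfolding sum.distrib[symmetric]
      by (rule sum.cong) (auto simp: b_def s_def nat_powr_line algebra_simps)
    finally have eq: "(\<Sum>n\<in>{1..<N}. b n * cis (- ln (real n) * t)) =
        dirichlet_partial c N s + of_real (e / 2)" ..
    have "\<bar>Re (dirichlet_partial c N s) - Re (dirichlet c s)\<bar> < e / 2"
      using N[of s] abs_Re_le_cmod[of "dirichlet_partial c N s - dirichlet c s"]
      by (simp add: s_def dist_norm)
    moreover have "0 \<le> Re (dirichlet c s)" by (rule nonneg) (simp add: s_def)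
    ultimately have "0 \<le> Re (dirichlet_partial c N s) + e / 2" by linarith
    then show ?thesis unfolding eq by simp
  qed
  from dirichlet_polynomial_coeff_bound[OF k kN this]
  have "cmod (b k) \<le> 2 * Re (b 1)" .
  then show "cmod (c k) * real k powr - \<sigma> \<le> 2 * Re (c 1) + e"
    using k by (simp add: b_def norm_mult)
qed

text \<open>
  The Harnack inequality on a ray. The point is that \<open>s1\<close> does not depend on the series: the
  coefficient bound on the line \<open>Re s = 1\<close> dominates the tail \<open>n \<ge> 2\<close> by \<open>Re (c 1)\<close> times a universal
  function of \<open>s\<close> that tends to 0.
\<close>

lemma dirichlet_near_constant_coeff:
  "\<exists>s1\<ge>1. \<forall>c s. uniform_limit (half_plane (1/2)) (dirichlet_partial c) (dirichlet c) sequentially \<longrightarrow>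
     (\<forall>z\<in>half_plane (1/2). 0 \<le> Re (dirichlet c z)) \<longrightarrow> s1 \<le> s \<longrightarrow>
     \<bar>Re (dirichlet c (of_real s)) - Re (c 1)\<bar> \<le> Re (c 1) / 2"
proof -
  define Z where "Z = (\<Sum>n. 1 / (real n)\<^sup>2)"
  have sumZ: "summable (\<lambda>n. 1 / (real n)\<^sup>2)"
    using inverse_power_summable[of 2, where 'a=real] by (simp add: inverse_eq_divide)
  have "((\<lambda>x. 2 * Z * 2 powr (3 - x)) \<longlongrightarrow> 2 * Z * 0) at_top"
    by real_asymp
  then have "\<forall>\<^sub>F x in at_top. 2 * Z * 2 powr (3 - x) < 1 / 2"
    by (rule order_tendstoD) simp
  then obtain s1' where s1': "\<And>x. s1' \<le> x \<Longrightarrow> 2 * Z * 2 powr (3 - x) < 1 / 2"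
    unfolding eventually_at_top_linorder by blast
  show ?thesis
  proof (intro exI[of _ "max 3 s1'"] conjI allI impI)
    fix c :: "nat \<Rightarrow> complex" and s :: real
    assume lim: "uniform_limit (half_plane (1/2)) (dirichlet_partial c) (dirichlet c) sequentially"
      and nonneg: "\<forall>z\<in>half_plane (1/2). 0 \<le> Re (dirichlet c z)" and s: "max 3 s1' \<le> s"
    have coeff: "cmod (c n) * real n powr - 1 \<le> 2 * Re (c 1)" if "2 \<le> n" for n
    proof (rule dirichlet_coeff_bound[OF _ _ that])
      show "uniform_limit {s. Re s = 1} (dirichlet_partial c) (dirichlet c) sequentially"
        by (rule uniform_limit_on_subset[OF lim]) (auto simp: half_plane_def)
    qed (use nonneg in \<open>auto simp: half_plane_def\<close>)
    have "0 \<le> cmod (c 2) * real 2 powr - 1" by simp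
    also have "\<dots> \<le> 2 * Re (c 1)" by (rule coeff) simp
    finally have c1: "0 \<le> Re (c 1)" by simp
    define h where "h n = c n * of_nat n powr - of_real s - (if n = 1 then c 1 else 0)" for n
    have "(\<lambda>N. dirichlet_partial c N (of_real s)) \<longlonglongrightarrow> dirichlet c (of_real s)"
      by (rule tendsto_uniform_limitI[OF lim]) (use s in \<open>auto simp: half_plane_def\<close>)
    then have "(\<lambda>n. c n * of_nat n powr - of_real s) sums dirichlet c (of_real s)"
      unfolding sums_def dirichlet_partial_def .
    from sums_diff[OF this sums_single[of 1 "\<lambda>_. c 1"]]
    have "h sums (dirichlet c (of_real s) - c 1)"
      unfolding h_def .
    then have "dirichlet c (of_real s) - c 1 = suminf h" by (simp add: sums_iff)
    also have "cmod \<dots> \<le> (\<Sum>n. 2 * Re (c 1) * 2 powr (3 - s) * (1 / (real n)\<^sup>2))"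
    proof (rule norm_suminf_le)
      show "summable (\<lambda>n. 2 * Re (c 1) * 2 powr (3 - s) * (1 / (real n)\<^sup>2))"
        by (intro summable_mult sumZ)
      fix n :: nat
      show "cmod (h n) \<le> 2 * Re (c 1) * 2 powr (3 - s) * (1 / (real n)\<^sup>2)"
      proof (cases "2 \<le> n")
        case True
        have "cmod (h n) = cmod (c n) * real n powr - s"
          using True norm_powr_real_powr[of "of_nat n" "- of_real s"] by (simp add: h_def norm_mult)
        \<comment> \<open>One power of \<open>n\<close> is used by the coefficient bound and two make the series converge;
          the remaining \<open>s - 3\<close> give decay in \<open>s\<close> because \<open>n \<ge> 2\<close>.\<close>
        also have "real n powr - s = real n powr - 1 * (real n powr (3 - s) * real n powr -2)"
          by (simp only: powr_add[symmetric]) simp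
        also have "cmod (c n) * \<dots> \<le> (2 * Re (c 1)) * (real n powr (3 - s) * real n powr -2)"
          unfolding mult.assoc[symmetric] using coeff[OF True] by (intro mult_right_mono) auto
        also have "\<dots> \<le> (2 * Re (c 1)) * (2 powr (3 - s) * real n powr -2)"
          using True s c1 by (intro mult_left_mono mult_right_mono powr_mono2') auto
        also have "real n powr -2 = 1 / (real n)\<^sup>2"
          using True by (simp add: powr_minus_divide)
        finally show ?thesis by simp
      next
        case False
        then have "n = 0 \<or> n = 1" by auto
        then show ?thesis using c1 by (auto simp: h_def)
      qed
    qed
    also have "\<dots> = Re (c 1) * (2 * Z * 2 powr (3 - s))"
      unfolding Z_def by (subst suminf_mult[OF sumZ]) simp
    also have "\<dots> \<le> Re (c 1) * (1 / 2)"
      using s1'[of s] s c1 by (intro mult_left_mono) auto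
    finally show "\<bar>Re (dirichlet c (of_real s)) - Re (c 1)\<bar> \<le> Re (c 1) / 2"
      using abs_Re_le_cmod[of "dirichlet c (of_real s) - c 1"] by simp
  qed simp
qed

section \<open>Point evaluations and operator norm distance\<close>

text \<open>
  Cauchy-Schwarz against the coefficients \<open>1 / n\<close>, which dominate those of every reproducing kernel
  at a point with \<open>Re s \<ge> 1\<close>; at \<open>n = 0\<close> both sides vanish.
\<close>

lemma hval_series_bound:
  assumes "1 \<le> Re s"
  shows "summable (\<lambda>n. cmod (hcoeff f n * of_nat n powr - s))" (is "summable ?u")
    and "cmod (hval f s) \<le> sqrt (\<Sum>n. 1 / (real n)\<^sup>2) * norm f"
proof -
  let ?K = "sqrt (\<Sum>n. 1 / (real n)\<^sup>2)"
  have sumZ: "summable (\<lambda>n. 1 / (real n)\<^sup>2)"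
    using inverse_power_summable[of 2, where 'a=real] by (simp add: inverse_eq_divide)
  have bound: "(\<Sum>n<N. ?u n) \<le> ?K * norm f" for N
  proof -
    have "cmod (of_nat n powr - s) \<le> 1 / real n" for n
    proof (cases "n = 0")
      case False
      then have "cmod (of_nat n powr - s) = real n powr - Re s"
        using norm_powr_real_powr[of "of_nat n" "- s"] by simp
      also have "\<dots> \<le> real n powr - 1"
        using False assms by (intro powr_mono) auto
      finally show ?thesis by (simp add: powr_minus_divide)
    qed simp
    then have "(\<Sum>n<N. ?u n) \<le> (\<Sum>n<N. cmod (hcoeff f n) * (1 / real n))"
      unfolding norm_mult by (intro sum_mono mult_left_mono) auto
    also have "\<dots> = (\<Sum>n<N. \<bar>cmod (hcoeff f n)\<bar> * \<bar>1 / real n\<bar>)" by simp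
    also have "\<dots> \<le> L2_set (\<lambda>n. cmod (hcoeff f n)) {..<N} * L2_set (\<lambda>n. 1 / real n) {..<N}"
      by (rule L2_set_mult_ineq)
    also have "\<dots> \<le> norm f * ?K"
      unfolding L2_set_def norm_hdir_def
      by (intro mult_mono real_sqrt_le_mono sum_le_suminf summable_hcoeff)
        (auto simp: power_divide sum_nonneg suminf_nonneg summable_hcoeff sumZ
          intro!: sum_le_suminf)
    finally show ?thesis by (simp add: mult.commute)
  qed
  show sum: "summable ?u" by (rule summableI_nonneg_bounded[OF _ bound]) simp
  have "cmod (hval f s) \<le> suminf ?u"
    unfolding hval_def dirichlet_def by (rule summable_norm[OF sum])
  also have "\<dots> \<le> ?K * norm f" by (rule suminf_le_const[OF sum bound])
  finally show "cmod (hval f s) \<le> ?K * norm f" .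
qed

lemma hval_diff:
  assumes "1 \<le> Re s"
  shows "hval (f - g) s = hval f s - hval g s"
  unfolding hval_def dirichlet_def
  by (subst suminf_diff) (auto simp: left_diff_distrib intro: summable_norm_cancel hval_series_bound(1)[OF assms])

text \<open>
  Testing both operators on the basis vector \<open>2\<^sup>-\<^sup>s\<close>, of norm 1. Two positive numbers that
  differ by less than half of the first have a ratio strictly between \<open>1/2\<close> and \<open>2\<close>, so their
  exponents to base 2 differ by less than 1.
\<close>

lemma close_comp_ops_close_symbols:
  assumes T: "is_comp_op \<phi> T" and S: "is_comp_op \<psi> S" and s: "1 \<le> Re s"
    and close: "sqrt (\<Sum>n. 1 / (real n)\<^sup>2) * norm (T - S) < 2 powr - Re (\<phi> s) / 2"
  shows "\<bar>Re (\<phi> s) - Re (\<psi> s)\<bar> < 1"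
proof -
  let ?K = "sqrt (\<Sum>n. 1 / (real n)\<^sup>2)"
  define e where "e = Abs_hdir (\<lambda>n. if n = 2 then 1 else 0)"
  have "summable (\<lambda>n. (cmod (if n = 2 then 1 else 0))\<^sup>2)"
    by (rule summable_finite[of "{2::nat}"]) auto
  then have e: "hcoeff e = (\<lambda>n. if n = 2 then 1 else 0)"
    unfolding e_def by (intro hcoeff_Abs) auto
  have val: "hval e z = 2 powr - z" for z
    unfolding hval_def dirichlet_def e by (subst suminf_finite[of "{2}"]) auto
  have norm: "norm e = 1"
    unfolding norm_hdir_def e by (subst suminf_finite[of "{2}"]) auto
  have mod: "cmod (2 powr - z) = 2 powr - Re z" for z :: complex
    using norm_powr_real_powr[of 2 "- z"] by simp
  have "s \<in> half_plane (1/2)" using s by (simp add: half_plane_def)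
  then have "hval (T e) s = 2 powr - \<phi> s" "hval (S e) s = 2 powr - \<psi> s"
    using T S val by (auto simp: is_comp_op_def)
  then have "2 powr - \<phi> s - 2 powr - \<psi> s = hval ((T - S) e) s"
    by (simp add: blinfun.diff_left hval_diff[OF s])
  then have "cmod (2 powr - \<phi> s - 2 powr - \<psi> s) \<le> ?K * norm ((T - S) e)"
    using hval_series_bound(2)[OF s] by metis
  also have "\<dots> \<le> ?K * norm (T - S)"
    using norm_blinfun[of "T - S" e] norm
    by (intro mult_left_mono) (auto intro!: real_sqrt_ge_zero suminf_nonneg
        simp: inverse_power_summable[of 2, where 'a=real, simplified inverse_eq_divide])
  finally have "\<bar>2 powr - Re (\<phi> s) - 2 powr - Re (\<psi> s)\<bar> < 2 powr - Re (\<phi> s) / 2"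
    using norm_triangle_ineq3[of "2 powr - \<phi> s" "2 powr - \<psi> s"] close unfolding mod by linarith
  moreover have "0 < 2 powr - Re (\<phi> s)" by simp
  ultimately have "2 powr - Re (\<phi> s) / 2 < 2 powr - Re (\<psi> s)"
      "2 powr - Re (\<psi> s) < 2 powr - Re (\<phi> s) * 2"
    by linarith+
  then have "2 powr (- Re (\<phi> s) - 1) < 2 powr - Re (\<psi> s)"
      "2 powr - Re (\<psi> s) < 2 powr (- Re (\<phi> s) + 1)"
    unfolding powr_diff powr_add by simp_all
  then have "- Re (\<phi> s) - 1 < - Re (\<psi> s)" "- Re (\<psi> s) < - Re (\<phi> s) + 1"
    by (simp_all only: powr_less_cancel_iff one_less_numeral_iff semiring_norm)
  then show ?thesis by linarith
qed

section \<open>Rigidity of the characteristic\<close>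

text \<open>
  Whether the characteristic is zero or positive, the conditions on the range of the Dirichlet
  series part make its real part nonnegative; this is what the Harnack inequality needs.
\<close>

lemma symbol_expansion:
  assumes "is_symbol k \<phi>"
  obtains c where
    "uniform_limit (half_plane (1/2)) (dirichlet_partial c) (dirichlet c) sequentially"
    "\<And>s. s \<in> half_plane (1/2) \<Longrightarrow> \<phi> s = of_nat k * s + dirichlet c s"
    "\<And>s. s \<in> half_plane (1/2) \<Longrightarrow> 0 \<le> Re (dirichlet c s)"
proof -
  obtain c where c: "\<forall>\<epsilon>>0. uniform_limit (half_plane \<epsilon>) (dirichlet_partial c) (dirichlet c) sequentially"
      "\<forall>s\<in>half_plane (1/2). \<phi> s = of_nat k * s + dirichlet c s"
      "k = 0 \<longrightarrow> dirichlet c ` half_plane 0 \<subseteq> half_plane (1/2)"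
      "k \<ge> 1 \<longrightarrow> ((\<forall>s\<in>half_plane 0. dirichlet c s = c 1) \<and> Re (c 1) \<ge> 0) \<or>
           dirichlet c ` half_plane 0 \<subseteq> half_plane 0"
    using assms unfolding is_symbol_def by blast
  have "0 \<le> Re (dirichlet c s)" if "s \<in> half_plane (1/2)" for s
  proof -
    have s: "s \<in> half_plane 0" using that by (simp add: half_plane_def)
    consider "k = 0" | "k \<ge> 1" by linarith
    then show ?thesis
    proof cases
      case 1
      then have "dirichlet c s \<in> half_plane (1/2)" using c(3) s by blast
      then show ?thesis by (simp add: half_plane_def)
    next
      case 2
      then have "(dirichlet c s = c 1 \<and> Re (c 1) \<ge> 0) \<or> dirichlet c s \<in> half_plane 0"
        using c(4) s by blast
      then show ?thesis by (auto simp: half_plane_def)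
    qed
  qed
  with c show ?thesis using that by (meson half_gt_zero_iff zero_less_one)
qed

text \<open>
  The two inequalities \<open>a < b\<close> and \<open>b < a\<close> fail at \<open>s0\<close> for different reasons. If \<open>a < b\<close>, the gap
  \<open>(b - a) s0\<close> exceeds the bound \<open>C\<close> on the Dirichlet part of \<open>\<phi>\<close>, and the Dirichlet part of \<open>\<psi>\<close>
  can only widen it. If \<open>b < a\<close>, the Dirichlet part of \<open>\<psi>\<close> would have to fill the gap, but it is at
  most \<open>4 * \<bar>m\<bar>\<close> at \<open>s0\<close> by the Harnack inequality and closeness at \<open>s1\<close>.
\<close>

lemma char_locally_constant:
  assumes \<phi>: "is_symbol a \<phi>" and T: "is_comp_op \<phi> T"
  shows "\<exists>\<epsilon>>0. \<forall>b \<psi> S. is_symbol b \<psi> \<longrightarrow> is_comp_op \<psi> S \<longrightarrow> norm (T - S) < \<epsilon> \<longrightarrow> b = a"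
proof -
  obtain s1 where s1: "1 \<le> s1" and near: "\<And>c s.
      uniform_limit (half_plane (1/2)) (dirichlet_partial c) (dirichlet c) sequentially \<Longrightarrow>
      (\<And>z. z \<in> half_plane (1/2) \<Longrightarrow> 0 \<le> Re (dirichlet c z)) \<Longrightarrow> s1 \<le> s \<Longrightarrow>
      \<bar>Re (dirichlet c (of_real s)) - Re (c 1)\<bar> \<le> Re (c 1) / 2"
    using dirichlet_near_constant_coeff by blast
  obtain c where c: "uniform_limit (half_plane (1/2)) (dirichlet_partial c) (dirichlet c) sequentially"
    "\<And>s. s \<in> half_plane (1/2) \<Longrightarrow> \<phi> s = of_nat a * s + dirichlet c s"
    "\<And>s. s \<in> half_plane (1/2) \<Longrightarrow> 0 \<le> Re (dirichlet c s)"
    using symbol_expansion[OF \<phi>] by blast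
  obtain C where C: "\<And>s. s \<in> half_plane (1/2) \<Longrightarrow> cmod (dirichlet c s) \<le> C"
    using uniform_dirichlet_bounded[OF c(1)] by blast
  define m where "m = Re (\<phi> (of_real s1)) + 1"
  define s0 where "s0 = max s1 (\<bar>C\<bar> + 4 * \<bar>m\<bar> + 1)"
  define K where "K = sqrt (\<Sum>n. 1 / (real n)\<^sup>2)"
  \<comment> \<open>\<open>K + 1\<close> rather than \<open>K\<close> keeps the denominator positive without evaluating \<open>K\<close>.\<close>
  define \<epsilon> where "\<epsilon> = min (2 powr - Re (\<phi> (of_real s1)) / 2) (2 powr - Re (\<phi> (of_real s0)) / 2) / (K + 1)"
  have K: "0 \<le> K" unfolding K_def
    by (auto intro!: real_sqrt_ge_zero suminf_nonneg
        simp: inverse_power_summable[of 2, where 'a=real, simplified inverse_eq_divide])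
  have "b = a" if \<psi>: "is_symbol b \<psi>" and S: "is_comp_op \<psi> S" and less: "norm (T - S) < \<epsilon>" for b \<psi> S
  proof -
    obtain d where d: "uniform_limit (half_plane (1/2)) (dirichlet_partial d) (dirichlet d) sequentially"
      "\<And>s. s \<in> half_plane (1/2) \<Longrightarrow> \<psi> s = of_nat b * s + dirichlet d s"
      "\<And>s. s \<in> half_plane (1/2) \<Longrightarrow> 0 \<le> Re (dirichlet d s)"
      using symbol_expansion[OF \<psi>] by blast
    have "K * norm (T - S) \<le> (K + 1) * norm (T - S)"
      by (intro mult_right_mono) auto
    also have "\<dots> < (K + 1) * \<epsilon>"
      using K less by (intro mult_strict_left_mono) auto
    also have "\<dots> = min (2 powr - Re (\<phi> (of_real s1)) / 2) (2 powr - Re (\<phi> (of_real s0)) / 2)"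
      using K by (simp add: \<epsilon>_def)
    finally have "K * norm (T - S) < 2 powr - Re (\<phi> (of_real s1)) / 2"
        "K * norm (T - S) < 2 powr - Re (\<phi> (of_real s0)) / 2"
      by auto
    then have close1: "\<bar>Re (\<phi> (of_real s1)) - Re (\<psi> (of_real s1))\<bar> < 1"
      and close0: "\<bar>Re (\<phi> (of_real s0)) - Re (\<psi> (of_real s0))\<bar> < 1"
      using s1 unfolding K_def s0_def
      by (auto intro!: close_comp_ops_close_symbols[OF T S])
    have "s1 \<le> s0" by (simp add: s0_def)
    with s1 have hp: "complex_of_real s1 \<in> half_plane (1/2)" "complex_of_real s0 \<in> half_plane (1/2)"
      using s1 by (auto simp: half_plane_def)
    have "Re (dirichlet d (of_real s1)) \<le> m"
    proof -
      have "0 \<le> real b * s1" using s1 by simp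
      then show ?thesis using close1 d(2)[OF hp(1)] by (simp add: m_def)
    qed
    \<comment> \<open>Both values lie between \<open>1/2\<close> and \<open>3/2\<close> times \<open>Re (d 1)\<close>, so they differ at most by a
      factor 3.\<close>
    then have d0: "Re (dirichlet d (of_real s0)) \<le> 4 * \<bar>m\<bar>"
      using near[OF d(1,3), of s1] near[OF d(1,3), of s0] d(3)[OF hp(1)] \<open>s1 \<le> s0\<close>
      by linarith
    have c0: "0 \<le> Re (dirichlet c (of_real s0))" "Re (dirichlet c (of_real s0)) \<le> C"
      using c(3)[OF hp(2)] C[OF hp(2)] abs_Re_le_cmod[of "dirichlet c (of_real s0)"] by auto
    have eqs: "Re (\<phi> (of_real s0)) = real a * s0 + Re (dirichlet c (of_real s0))"
      "Re (\<psi> (of_real s0)) = real b * s0 + Re (dirichlet d (of_real s0))"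
      using c(2)[OF hp(2)] d(2)[OF hp(2)] by auto
    have s0: "\<bar>C\<bar> + 4 * \<bar>m\<bar> + 1 \<le> s0" by (simp add: s0_def)
    show "b = a"
    proof (rule linorder_cases[of a b])
      assume "a < b"
      then have "(real a + 1) * s0 \<le> real b * s0" using s0 by (intro mult_right_mono) auto
      then show ?thesis
        using close0 c0 d(3)[OF hp(2)] s0 unfolding eqs by (simp add: distrib_right)
    next
      assume "b < a"
      then have "(real b + 1) * s0 \<le> real a * s0" using s0 by (intro mult_right_mono) auto
      then show ?thesis
        using close0 c0 d0 s0 unfolding eqs by (simp add: distrib_right)
    qed simp
  qed
  moreover have "0 < \<epsilon>" using K by (simp add: \<epsilon>_def)
  ultimately show ?thesis by blast
qed

theorem theorem3p1:
  shows "continuous_map (top_of_set comp_ops) (discrete_topology (UNIV :: nat set)) op_char"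
proof -
  have "openin (top_of_set comp_ops) {T \<in> comp_ops. op_char T \<in> U}" for U
    unfolding openin_euclidean_subtopology_iff
  proof (intro conjI ballI)
    fix T assume "T \<in> {T \<in> comp_ops. op_char T \<in> U}"
    then obtain \<phi> a where \<phi>: "is_symbol a \<phi>" "is_comp_op \<phi> T" and U: "op_char T \<in> U"
      by (auto simp: comp_ops_def GH_class_def)
    have char: "op_char S = b" if "is_symbol b \<psi>" "is_comp_op \<psi> S" for b \<psi> S
      using that op_char_eq char_of_eq by (metis (mono_tags) GH_class_def mem_Collect_eq)
    obtain \<epsilon> where \<epsilon>: "0 < \<epsilon>"
      "\<And>b \<psi> S. is_symbol b \<psi> \<Longrightarrow> is_comp_op \<psi> S \<Longrightarrow> norm (T - S) < \<epsilon> \<Longrightarrow> b = a"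
      using char_locally_constant[OF \<phi>] by blast
    have "op_char S = op_char T" if "S \<in> comp_ops" "dist S T < \<epsilon>" for S
    proof -
      obtain \<psi> b where \<psi>: "is_symbol b \<psi>" "is_comp_op \<psi> S"
        using \<open>S \<in> comp_ops\<close> by (auto simp: comp_ops_def GH_class_def)
      then have "b = a" using \<epsilon>(2) that(2) by (metis dist_commute dist_norm)
      then show ?thesis using char[OF \<phi>] char[OF \<psi>] by simp
    qed
    with \<epsilon>(1) U show "\<exists>e>0. \<forall>S\<in>comp_ops. dist S T < e \<longrightarrow> S \<in> {T \<in> comp_ops. op_char T \<in> U}"
      by auto
  qed auto
  then show ?thesis by (auto simp: continuous_map_def)
qed

end
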